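(* For $\alpha\in[-1,1/2]$, the function $f_\alpha:[0,1]\to\mathbb R$ has the unique maximizer $t=1/2$ and the maximum value $f_\alpha(1/2)=1/2$.
   Context: For $\alpha\in(-2,2)$, $f_\alpha(t)=\sum_{m=0}^\infty\frac{\alpha^m}{2^m}\phi(2^mt)$, $t\in[0,1]$, where $\phi(t)=\min_{z\in\mathbb Z}|t-z|$. *)

theory Defs
  imports "HOL-Analysis.Analysis"
begin

definition tent :: "real \<Rightarrow> real" where
  "tent t = (INF z::int. \<bar>t - of_int z\<bar>)"

text \<open>The infimum is attained, so \<^const>\<open>tent\<close> is the minimum over the integers.\<close>

lemma tent_eq: "tent t = \<bar>t - of_int (round t)\<bar>"
  unfolding tent_def
proof (rule cInf_eq_minimum)
  show "\<bar>t - of_int (round t)\<bar> \<in> range (\<lambda>z::int. \<bar>t - of_int z\<bar>)"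
    by blast
  show "\<bar>t - of_int (round t)\<bar> \<le> x" if "x \<in> range (\<lambda>z::int. \<bar>t - of_int z\<bar>)" for x
    using that round_diff_minimal[of t] by auto
qed

text \<open>For \<open>\<alpha> = 0\<close> only the term with \<open>m = 0\<close> survives, since \<open>0 ^ 0 = 1\<close>.\<close>

definition takagi :: "real \<Rightarrow> real \<Rightarrow> real" where
  "takagi \<alpha> t = (\<Sum>m. \<alpha> ^ m / 2 ^ m * tent (2 ^ m * t))"

text \<open>For \<open>\<alpha> \<in> (-2, 2)\<close> the series converges, so the value of \<^const>\<open>takagi\<close> is a genuine sum.\<close>

lemma summable_takagi:
  assumes "\<alpha> \<in> {-2<..<2}"
  shows "summable (\<lambda>m. \<alpha> ^ m / 2 ^ m * tent (2 ^ m * t))"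
proof (rule summable_comparison_test')
  show "summable (\<lambda>m. \<bar>\<alpha> / 2\<bar> ^ m)"
    using assms by (intro summable_geometric) auto
  show "norm (\<alpha> ^ m / 2 ^ m * tent (2 ^ m * t)) \<le> \<bar>\<alpha> / 2\<bar> ^ m" for m
  proof -
    have "\<bar>tent (2 ^ m * t)\<bar> \<le> 1"
      unfolding tent_eq using of_int_round_abs_le[of "2 ^ m * t"] by linarith
    then have "\<bar>\<alpha> / 2\<bar> ^ m * \<bar>tent (2 ^ m * t)\<bar> \<le> \<bar>\<alpha> / 2\<bar> ^ m"
      by (intro mult_left_le) auto
    then show ?thesis
      by (simp add: abs_mult power_abs power_divide)
  qed
qed

end

theory Submission
  imports Defs
begin

text \<open>
  The functional equation \<open>f\<^sub>\<alpha>(t) = \<phi>(t) + (\<alpha>/2) f\<^sub>\<alpha>(2t)\<close> gives everything, because a bounded function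
  with \<open>c D(g t) \<le> D t\<close> for a constant \<open>0 \<le> c < 1\<close> is nonnegative. Applied to \<open>f\<^sub>\<alpha>\<close> (with the equation
  iterated twice and \<open>\<phi>(2t) \<le> 2 \<phi>(t)\<close> when \<open>\<alpha> < 0\<close>), this yields \<open>f\<^sub>\<alpha> \<ge> 0\<close>. Hence the difference between
  the bounded solution \<open>h = 2\<phi>(1 - \<phi>)\<close> of \<open>h(t) = \<phi>(t) + h(2t)/4\<close> and \<open>f\<^sub>\<alpha>\<close> satisfies the condition with
  \<open>c = 1/4\<close>, so \<open>f\<^sub>\<alpha> \<le> h = 1/2 - 2(1/2 - \<phi>)\<^sup>2\<close>.
\<close>

lemma tent_le: "tent t \<le> \<bar>t - of_int z\<bar>"
  unfolding tent_eq by (rule round_diff_minimal)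

lemma tent_nonneg: "0 \<le> tent t"
  unfolding tent_eq by simp

lemma tent_le_half: "tent t \<le> 1/2"
  unfolding tent_eq using of_int_round_abs_le[of t] by linarith

lemma tent_double_le: "tent (2 * t) \<le> 2 * tent t"
proof -
  have "tent (2 * t) \<le> \<bar>2 * t - of_int (2 * round t)\<bar>"
    by (rule tent_le)
  also have "\<dots> = 2 * tent t"
    unfolding tent_eq by (simp add: abs_if)
  finally show ?thesis .
qed

text \<open>Since t is within 1/2 of its nearest integer, the nearest integer to 2t differs from
  twice that integer by at most 3/2, hence by -1, 0 or 1.\<close>

lemma tent_double: "tent (2 * t) = 2 * tent t \<or> tent (2 * t) = 1 - 2 * tent t"
proof -
  define k where "k = round (2 * t) - 2 * round t"
  define d where "d = t - of_int (round t)"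
  have d: "\<bar>d\<bar> \<le> 1/2" "tent t = \<bar>d\<bar>"
    using tent_le_half[of t] by (simp_all add: d_def tent_eq)
  have "2 * t - of_int (round (2 * t)) = 2 * d - of_int k"
    by (simp add: k_def d_def)
  then have k: "\<bar>2 * d - of_int k\<bar> \<le> 1/2" "tent (2 * t) = \<bar>2 * d - of_int k\<bar>"
    using tent_le_half[of "2 * t"] by (simp_all add: tent_eq)
  have "real_of_int k < 2" "- 2 < real_of_int k"
    using d(1) k(1) by linarith+
  then consider "k = -1" | "k = 0" | "k = 1"
    by linarith
  then show ?thesis
    using d k by cases auto
qed

text \<open>Makes the maximizer unique: equality in the parabola bound at height 1/2 forces
  \<open>tent t = 1/2\<close>. The distances to 0 and 1 then pin down t.\<close>

lemma tent_eq_half_iff: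
  assumes "t \<in> {0..1}"
  shows "tent t = 1/2 \<longleftrightarrow> t = 1/2"
proof
  assume "tent t = 1/2"
  with tent_le[of t 0] tent_le[of t 1] assms show "t = 1/2"
    by auto
next
  assume t: "t = 1/2"
  \<comment> \<open>As \<open>tent 1 = 0\<close>, doubling 1/2 leaves only the values 0 and 1/2;
    parity excludes 0.\<close>
  have "tent (1/2) \<noteq> 0"
  proof
    assume "tent (1/2) = 0"
    then have "1 = real_of_int (2 * round (1/2 :: real))"
      unfolding tent_eq by simp
    then have "1 = 2 * round (1/2 :: real)"
      by linarith
    then show False
      by presburger
  qed
  moreover have "tent 1 = 0"
    by (simp add: tent_eq)
  ultimately have "tent (1/2) = 1/2"
    using tent_double[of "1/2"] by auto
  with t show "tent t = 1/2"
    by (simp only:)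
qed

lemma takagi_rec:
  assumes "\<alpha> \<in> {-2<..<2}"
  shows "takagi \<alpha> t = tent t + \<alpha> / 2 * takagi \<alpha> (2 * t)"
proof -
  have "takagi \<alpha> t = tent t + (\<Sum>m. \<alpha> ^ Suc m / 2 ^ Suc m * tent (2 ^ Suc m * t))"
    unfolding takagi_def using suminf_split_head[OF summable_takagi[OF assms, of t]] by simp
  also have "(\<lambda>m. \<alpha> ^ Suc m / 2 ^ Suc m * tent (2 ^ Suc m * t)) =
      (\<lambda>m. \<alpha> / 2 * (\<alpha> ^ m / 2 ^ m * tent (2 ^ m * (2 * t))))"
    by (simp add: mult_ac)
  also have "suminf \<dots> = \<alpha> / 2 * takagi \<alpha> (2 * t)"
    unfolding takagi_def by (rule suminf_mult[OF summable_takagi[OF assms]])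
  finally show ?thesis .
qed

text \<open>Supplies the boundedness that the contraction argument needs. The bound covers all real
  t because doubling leaves the unit interval.\<close>

lemma takagi_abs_le:
  assumes "\<alpha> \<in> {-2<..<2}"
  shows "\<bar>takagi \<alpha> t\<bar> \<le> (\<Sum>m. \<bar>\<alpha> / 2\<bar> ^ m)"
proof -
  have "norm (\<alpha> ^ m / 2 ^ m * tent (2 ^ m * t)) \<le> \<bar>\<alpha> / 2\<bar> ^ m" for m
  proof -
    have "\<bar>\<alpha> / 2\<bar> ^ m * \<bar>tent (2 ^ m * t)\<bar> \<le> \<bar>\<alpha> / 2\<bar> ^ m"
      using tent_nonneg[of "2 ^ m * t"] tent_le_half[of "2 ^ m * t"]
      by (intro mult_left_le) auto
    then show ?thesis
      by (simp add: abs_mult power_abs power_divide)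
  qed
  moreover have "summable (\<lambda>m. \<bar>\<alpha> / 2\<bar> ^ m)"
    using assms by (intro summable_geometric) auto
  ultimately show ?thesis
    unfolding takagi_def real_norm_def[symmetric] by (intro norm_suminf_le)
qed

text \<open>The infimum i of \<open>D\<close> satisfies c i \<le> c \<open>D (g t)\<close> \<le>
  \<open>D t\<close> for every t, so c i \<le> i, and c < 1 forces i \<ge> 0.\<close>

lemma nonneg_if_bdd_below_contraction:
  fixes D :: "'a \<Rightarrow> real"
  assumes "bdd_below (range D)" and "0 \<le> c" "c < 1" and "\<And>t. c * D (g t) \<le> D t"
  shows "0 \<le> D t"
proof -
  define i where "i = (INF t. D t)"
  have i: "i \<le> D t" for t
    unfolding i_def using assms(1) by (intro cINF_lower) auto
  have "c * i \<le> D t" for t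
    using mult_left_mono[OF i \<open>0 \<le> c\<close>] assms(4) by (rule order_trans)
  then have "c * i \<le> i"
    unfolding i_def by (intro cINF_greatest) auto
  then have "0 \<le> (1 - c) * i"
    by (simp add: algebra_simps)
  with \<open>c < 1\<close> have "0 \<le> i"
    by (simp add: zero_le_mult_iff)
  then show ?thesis
    using i by (rule order_trans)
qed

lemma takagi_nonneg:
  assumes "\<alpha> \<in> {-1..<2}"
  shows "0 \<le> takagi \<alpha> t"
proof -
  have \<alpha>: "\<alpha> \<in> {-2<..<2}"
    using assms by auto
  have bdd: "bdd_below (range (takagi \<alpha>))"
    using takagi_abs_le[OF \<alpha>] by (intro bdd_belowI2[where m = "- (\<Sum>m. \<bar>\<alpha> / 2\<bar> ^ m)"])
      (simp add: abs_le_iff minus_le_iff)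
  show ?thesis
  proof (cases "0 \<le> \<alpha>")
    case True
    show ?thesis
    proof (rule nonneg_if_bdd_below_contraction[OF bdd, where c = "\<alpha> / 2" and g = "\<lambda>t. 2 * t"])
      show "\<alpha> / 2 * takagi \<alpha> (2 * t) \<le> takagi \<alpha> t" for t
        using takagi_rec[OF \<alpha>, of t] tent_nonneg[of t] by simp
    qed (use True assms in auto)
  next
    case False
    show ?thesis
    proof (rule nonneg_if_bdd_below_contraction[OF bdd, where c = "(\<alpha> / 2)\<^sup>2" and g = "\<lambda>t. 4 * t"])
      show "(\<alpha> / 2)\<^sup>2 * takagi \<alpha> (4 * t) \<le> takagi \<alpha> t" for t
      proof -
        have "takagi \<alpha> t = tent t + \<alpha> / 2 * (tent (2 * t) + \<alpha> / 2 * takagi \<alpha> (4 * t))"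
          using takagi_rec[OF \<alpha>, of t] takagi_rec[OF \<alpha>, of "2 * t"] by simp
        also have "\<dots> = (tent t + \<alpha> / 2 * tent (2 * t)) + (\<alpha> / 2)\<^sup>2 * takagi \<alpha> (4 * t)"
          by (simp add: algebra_simps power2_eq_square)
        finally have eq: "takagi \<alpha> t = \<dots>" .
        \<comment> \<open>Here \<alpha> \<ge> -1 enters: the first two terms of the series together
          are nonnegative.\<close>
        have "- \<alpha> / 2 * tent (2 * t) \<le> 1 / 2 * (2 * tent t)"
          using assms False tent_double_le[of t] tent_nonneg[of "2 * t"] by (intro mult_mono) auto
        with eq show ?thesis
          by simp
      qed
      have "\<bar>\<alpha> / 2\<bar> < 1"
        using assms by auto
      then show "(\<alpha> / 2)\<^sup>2 < 1"
        by (simp add: abs_square_less_1)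
    qed simp
  qed
qed

text \<open>The right-hand side is \<^term>\<open>takagi (1/2) t\<close>.\<close>

lemma takagi_le_parabola:
  assumes "\<alpha> \<in> {-1..1/2}"
  shows "takagi \<alpha> t \<le> 2 * tent t * (1 - tent t)"
proof -
  have \<alpha>: "\<alpha> \<in> {-2<..<2}"
    using assms by auto
  define h where "h t = 2 * tent t * (1 - tent t)" for t
  \<comment> \<open>With x = \<open>tent t\<close>, the two possible values 2x and 1 - 2x of
    \<open>tent (2 * t)\<close> are swapped by y -> 1 - y, which preserves 2y(1 - y). Either way
    \<open>h (2 * t)\<close> is 4x(1 - 2x).\<close>
  have h_rec: "h t = tent t + 1/4 * h (2 * t)" for t
    using tent_double[of t] unfolding h_def by (elim disjE; simp only:) (simp_all add: algebra_simps)
  have h_nonneg: "0 \<le> h t" for t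
    using tent_nonneg[of t] tent_le_half[of t] unfolding h_def by (intro mult_nonneg_nonneg) auto
  have "0 \<le> h t - takagi \<alpha> t"
  proof (rule nonneg_if_bdd_below_contraction[where D = "\<lambda>t. h t - takagi \<alpha> t" and c = "1/4" and g = "\<lambda>t. 2 * t"])
    show "bdd_below (range (\<lambda>t. h t - takagi \<alpha> t))"
    proof (rule bdd_belowI2)
      show "- (\<Sum>m. \<bar>\<alpha> / 2\<bar> ^ m) \<le> h t - takagi \<alpha> t" for t
        using takagi_abs_le[OF \<alpha>, of t] h_nonneg[of t] by linarith
    qed
    show "1/4 * (h (2 * t) - takagi \<alpha> (2 * t)) \<le> h t - takagi \<alpha> t" for t
    proof -
      \<comment> \<open>Here \<alpha> \<le> 1/2 enters; nonnegativity of \<open>takagi\<close> lets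
        the coefficient be raised to 1/4.\<close>
      have "\<alpha> / 2 * takagi \<alpha> (2 * t) \<le> 1/4 * takagi \<alpha> (2 * t)"
        using assms by (intro mult_right_mono takagi_nonneg) auto
      then show ?thesis
        using takagi_rec[OF \<alpha>, of t] h_rec[of t] by simp
    qed
  qed auto
  then show ?thesis
    by (simp add: h_def)
qed

theorem proposition3p6:
  fixes \<alpha> :: real
  assumes "\<alpha> \<in> {-1..1/2}"
  shows "(\<forall>t. is_arg_max (takagi \<alpha>) (\<lambda>s. s \<in> {0..1}) t \<longleftrightarrow> t = 1/2) \<and> takagi \<alpha> (1/2) = 1/2"
proof -
  have \<alpha>: "\<alpha> \<in> {-2<..<2}"
    using assms by auto
  \<comment> \<open>All the points 2^m are integers, so in the functional equation at 1/2 only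
    \<open>tent (1/2)\<close> survives.\<close>
  have "takagi \<alpha> 1 = 0"
  proof -
    have "tent (2 ^ m) = 0" for m
      using tent_le[of "2 ^ m" "2 ^ m"] tent_nonneg[of "2 ^ m"] by simp
    then show ?thesis
      by (simp add: takagi_def)
  qed
  then have half: "takagi \<alpha> (1/2) = 1/2"
    using takagi_rec[OF \<alpha>, of "1/2"] tent_eq_half_iff[of "1/2"] by simp
  have less: "takagi \<alpha> t < 1/2" if "t \<in> {0..1}" "t \<noteq> 1/2" for t
  proof -
    have "1/2 - tent t \<noteq> 0"
      using tent_eq_half_iff that by auto
    then have "0 < 2 * (1/2 - tent t)\<^sup>2"
      by simp
    also have "\<dots> = 1/2 - 2 * tent t * (1 - tent t)"
      by (simp add: power2_eq_square algebra_simps)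
    finally show ?thesis
      using takagi_le_parabola[OF assms, of t] by linarith
  qed
  have "is_arg_max (takagi \<alpha>) (\<lambda>s. s \<in> {0..1}) t \<longleftrightarrow> t = 1/2" for t
  proof
    assume "is_arg_max (takagi \<alpha>) (\<lambda>s. s \<in> {0..1}) t"
    then have "t \<in> {0..1}" "\<not> takagi \<alpha> t < takagi \<alpha> (1/2)"
      by (auto simp: is_arg_max_def)
    with less[of t] half show "t = 1/2"
      by force
  next
    have "takagi \<alpha> s \<le> takagi \<alpha> (1/2)" if "s \<in> {0..1}" for s
      using less[OF that] half by (metis less_imp_le order_refl)
    then have "is_arg_max (takagi \<alpha>) (\<lambda>s. s \<in> {0..1}) (1/2)"
      by (fastforce simp: is_arg_max_def not_less[symmetric])
    moreover assume "t = 1/2"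
    ultimately show "is_arg_max (takagi \<alpha>) (\<lambda>s. s \<in> {0..1}) t"
      by (simp only:)
  qed
  with half show ?thesis
    by blast
qed

end
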